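(* Let $X$ be an $L$-dimensional zero-mean Gaussian random vector with covariance $\Sigma_X=\Theta^T\Lambda_X\Theta\succ0$, where $\Theta$ is unitary and $\Lambda_X=\mathrm{diag}(\lambda_1,\ldots,\lambda_L)$ with $\lambda_\ell>0$. With the KL divergence $D(P_{\hat X}\|P_X)$ as the perception metric, the rate-distortion-perception function $R(D,P)$ is given by $$R(D,P)=\min_{\{\hat\lambda_\ell,\gamma_\ell\}_{\ell=1}^L}\ \frac12\sum_{\ell=1}^L\log\frac{\lambda_\ell}{\gamma_\ell}$$ subject to $0<\gamma_\ell\le\lambda_\ell$ and $0\le\hat\lambda_\ell$ for all $\ell$, $\sum_{\ell=1}^L D_\ell(\gamma_\ell,\hat\lambda_\ell)\le D$, and $\sum_{\ell=1}^L P_\ell(\hat\lambda_\ell)\le P$, where $$D_\ell(\gamma_\ell,\hat\lambda_\ell)=\lambda_\ell-2\sqrt{\hat\lambda_\ell(\lambda_\ell-\gamma_\ell)}+\hat\lambda_\ell,\qquad P_\ell(\hat\lambda_\ell)=\frac12\Big(\frac{\hat\lambda_\ell}{\lambda_\ell}-1+\log\frac{\lambda_\ell}{\hat\lambda_\ell}\Big).$$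
   Context: The (information) rate-distortion-perception function is $R(D,P)=\inf I(X;\hat X)$ over conditional distributions $P_{\hat X|X}$, $\hat X\in\mathbb{R}^L$, such that $\mathbb{E}[\|X-\hat X\|^2]\le D$ and $D(P_{\hat X}\|P_X)\le P$, where $D(P_{\hat X}\|P_X)=\int P_{\hat X}(x)\log\frac{P_{\hat X}(x)}{P_X(x)}dx$. Logarithms are natural. *)

theory Defs
  imports "HOL-Analysis.Analysis" "HOL-Probability.Probability"
begin

text \<open>Kullback-Leibler divergence D(P||Q) = integral of log(dP/dQ) dP, written as
  the integral of f ln f dQ with f = dP/dQ; it is +infinity if P is not absolutely
  continuous w.r.t. Q or the integral diverges. Natural logarithm.\<close>
definition KL_div :: "'a measure \<Rightarrow> 'a measure \<Rightarrow> ereal" where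
  "KL_div P Q =
     (let f = (\<lambda>x. enn2real (RN_deriv Q P x)) in
      if absolutely_continuous Q P \<and> sets P = sets Q \<and> integrable Q (\<lambda>x. f x * ln (f x))
      then ereal (\<integral>x. f x * ln (f x) \<partial>Q) else \<infinity>)"

definition mutual_info :: "('a::topological_space \<times> 'b::topological_space) measure \<Rightarrow> ereal" where
  "mutual_info \<mu> = KL_div \<mu> (distr \<mu> borel fst \<Otimes>\<^sub>M distr \<mu> borel snd)"

text \<open>Joint laws of (X, Xhat) with X-marginal PX, i.e. all choices of P_{Xhat|X}.\<close>
definition couplings :: "(real^'n) measure \<Rightarrow> ((real^'n) \<times> (real^'n)) measure set" where
  "couplings PX = {\<mu>. prob_space \<mu> \<and> sets \<mu> = sets (borel \<Otimes>\<^sub>M borel) \<and> distr \<mu> borel fst = PX}"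

definition RDP :: "(real^'n) measure \<Rightarrow> real \<Rightarrow> real \<Rightarrow> ereal" where
  "RDP PX D P = (INF \<mu> \<in> {\<mu> \<in> couplings PX.
        (\<integral>\<^sup>+ z. ennreal ((norm (fst z - snd z))\<^sup>2) \<partial>\<mu>) \<le> ennreal D
      \<and> KL_div (distr \<mu> borel snd) PX \<le> ereal P}. mutual_info \<mu>)"

definition gaussian_vec :: "real^'n^'n \<Rightarrow> (real^'n) measure" where
  "gaussian_vec S = density lborel (\<lambda>x. ennreal
      ((2 * pi) powr (- real CARD('n) / 2) * det S powr (-1/2)
        * exp (- (x \<bullet> (matrix_inv S *v x)) / 2)))"

definition diag_mat :: "real^'n \<Rightarrow> real^'n^'n" where
  "diag_mat v = (\<chi> i j. if i = j then v $ i else 0)"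

definition D_l :: "real \<Rightarrow> real \<Rightarrow> real \<Rightarrow> real" where
  "D_l lam g lh = lam - 2 * sqrt (lh * (lam - g)) + lh"

definition P_l :: "real \<Rightarrow> real \<Rightarrow> ereal" where
  "P_l lam lh = (if lh = 0 then \<infinity> else ereal ((lh / lam - 1 + ln (lam / lh)) / 2))"

definition rdp_feasible :: "real^'n \<Rightarrow> real \<Rightarrow> real \<Rightarrow> real^'n \<Rightarrow> real^'n \<Rightarrow> bool" where
  "rdp_feasible lam D P lh g \<longleftrightarrow>
     (\<forall>l. 0 < g $ l \<and> g $ l \<le> lam $ l \<and> 0 \<le> lh $ l)
   \<and> (\<Sum>l\<in>UNIV. D_l (lam $ l) (g $ l) (lh $ l)) \<le> D
   \<and> (\<Sum>l\<in>UNIV. P_l (lam $ l) (lh $ l)) \<le> ereal P"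

definition rdp_obj :: "real^'n \<Rightarrow> real^'n \<Rightarrow> real" where
  "rdp_obj lam g = (1/2) * (\<Sum>l\<in>UNIV. ln (lam $ l / g $ l))"

end

theory Submission
  imports Defs
begin

text \<open>
  Lower bound: if \<open>\<integral> exp h dQ \<le> 1\<close> then \<open>KL(P || Q) \<ge> \<integral> h dP\<close>. In the eigenbasis of the source, let
  \<open>m\<^sub>l\<close> be the second moment of the reconstruction and \<open>c\<^sub>l\<close> its correlation with the source. Taking for
  \<open>h\<close> the log-likelihood ratio of a Gaussian backward channel (respectively of a Gaussian with second
  moments \<open>m\<^sub>l\<close>) against the source law bounds the mutual information (respectively the perception
  divergence) from below by the values at \<open>\<gamma>\<^sub>l = \<lambda>\<^sub>l - c\<^sub>l\<^sup>2 / m\<^sub>l\<close> and \<open>m\<^sub>l\<close>, which form a feasible point. The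
  degenerate cases \<open>m\<^sub>l = 0\<close> and \<open>\<gamma>\<^sub>l = 0\<close> are excluded since the same bounds with variance tending
  to \<open>0\<close> would make the divergence infinite.

  Attainment: for a feasible point the joint law with backward channel
  \<open>N(a\<^sub>l w\<^sub>l, \<gamma>\<^sub>l)\<close>, \<open>a\<^sub>l = sqrt ((\<lambda>\<^sub>l - \<gamma>\<^sub>l) / m\<^sub>l)\<close>, has that log-likelihood ratio as its log density
  with respect to the product of its marginals. A minimiser of the finite-dimensional problem exists
  because its sublevel sets are compact.
\<close>

section \<open>Rotation invariance of Lebesgue measure\<close>

lemma nn_integral_lborel_translate:
  fixes F :: "'a::euclidean_space \<Rightarrow> ennreal"
  assumes [measurable]: "F \<in> borel_measurable borel"
  shows "(\<integral>\<^sup>+x. F (x + c) \<partial>lborel) = (\<integral>\<^sup>+x. F x \<partial>lborel)"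
proof -
  have "(\<integral>\<^sup>+x. F x \<partial>lborel) = (\<integral>\<^sup>+x. F x \<partial>distr lborel borel ((+) c))"
    by (simp add: lborel_distr_plus)
  also have "\<dots> = (\<integral>\<^sup>+x. F (x + c) \<partial>lborel)"
    by (simp add: nn_integral_distr add.commute)
  finally show ?thesis ..
qed

text \<open>Uniqueness of translation-invariant measures: both sides are compared after
  multiplication with the volume of the unit ball, which the map preserves.\<close>

lemma nn_integral_lborel_orthogonal_transformation:
  fixes F :: "'a::euclidean_space \<Rightarrow> ennreal"
  assumes f: "orthogonal_transformation (f :: 'a \<Rightarrow> 'a)" and F[measurable]: "F \<in> borel_measurable borel"
  shows "(\<integral>\<^sup>+x. F (f x) \<partial>lborel) = (\<integral>\<^sup>+x. F x \<partial>lborel)"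
proof -
  have lin: "linear f" using f by (rule orthogonal_transformation_linear)
  have [measurable]: "f \<in> borel_measurable borel"
    using lin by (intro borel_measurable_continuous_onI linear_continuous_on linear_conv_bounded_linear[THEN iffD1])
  define G :: "'a \<Rightarrow> ennreal" where "G = indicator (ball 0 1)"
  have [measurable]: "G \<in> borel_measurable borel" unfolding G_def by (intro borel_measurable_indicator) simp
  have G: "G (- f x) = G x" for x
    using orthogonal_transformation_norm[OF f, of x] by (simp add: G_def indicator_def)
  define V where "V = (\<integral>\<^sup>+y. G y \<partial>lborel)"
  have V: "V = emeasure lborel (ball (0::'a) 1)" by (simp add: V_def G_def)
  have "0 < measure lborel (ball (0::'a) 1)" by (rule content_ball_pos) simp
  then have "V \<noteq> 0" unfolding V measure_def by (metis enn2real_0 less_irrefl)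
  have "V \<noteq> \<infinity>" unfolding V using emeasure_lborel_ball_finite[of "0::'a" 1] by simp
  have sur: "surj f" using f by (rule orthogonal_transformation_surj)
  have "(\<integral>\<^sup>+x. F (f x) \<partial>lborel) * V = (\<integral>\<^sup>+x. F (f x) * V \<partial>lborel)"
    by (simp add: nn_integral_multc)
  also have "\<dots> = (\<integral>\<^sup>+x. (\<integral>\<^sup>+y. F (f x) * G (y + - f x) \<partial>lborel) \<partial>lborel)"
    by (simp add: nn_integral_cmult nn_integral_lborel_translate V_def del: add_uminus_conv_diff)
  also have "\<dots> = (\<integral>\<^sup>+y. (\<integral>\<^sup>+x. F (f x) * G (y + - f x) \<partial>lborel) \<partial>lborel)"
    by (rule lborel_pair.Fubini') simp
  \<comment> \<open>Translating \<open>x\<close> by a preimage \<open>z\<close> of \<open>y\<close>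
    moves \<open>y\<close> from the argument of \<open>G\<close> to that of \<open>F\<close>. After
    the next exchange the inner integral over \<open>y\<close> is that of a translate of
    \<open>F\<close>.\<close>
  also have "\<dots> = (\<integral>\<^sup>+y. (\<integral>\<^sup>+x. F (f x + y) * G (- f x) \<partial>lborel) \<partial>lborel)"
  proof (rule nn_integral_cong)
    fix y :: 'a
    obtain z where z: "f z = y" using sur by (metis surj_def)
    show "(\<integral>\<^sup>+x. F (f x) * G (y + - f x) \<partial>lborel) = (\<integral>\<^sup>+x. F (f x + y) * G (- f x) \<partial>lborel)"
      by (subst nn_integral_lborel_translate[symmetric, where c=z])
         (simp_all add: linear_add[OF lin] z)
  qed
  also have "\<dots> = (\<integral>\<^sup>+x. (\<integral>\<^sup>+y. F (f x + y) * G (- f x) \<partial>lborel) \<partial>lborel)"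
    by (rule lborel_pair.Fubini') simp
  also have "\<dots> = (\<integral>\<^sup>+x. (\<integral>\<^sup>+y. F (y + f x) \<partial>lborel) * G x \<partial>lborel)"
    by (simp add: nn_integral_multc G add.commute)
  also have "\<dots> = (\<integral>\<^sup>+x. F x \<partial>lborel) * V"
    by (simp add: nn_integral_lborel_translate nn_integral_cmult V_def)
  finally show ?thesis
    using \<open>V \<noteq> 0\<close> \<open>V \<noteq> \<infinity>\<close> by (metis ennreal_mult_divide_eq infinity_ennreal_def)
qed

section \<open>Variational bound for the divergence\<close>

text \<open>Young's inequality for the convex conjugates \<open>f * ln f - f\<close> and
  \<open>exp h\<close>: it is \<open>1 + u \<le> exp u\<close> at \<open>u = h - ln f\<close>,
  multiplied by \<open>f\<close>.\<close>

lemma mult_ln_ge_tangent: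
  fixes f h :: real
  assumes "0 \<le> f"
  shows "f * h + f - exp h \<le> f * ln f"
proof (cases "f = 0")
  case False
  with assms have "0 < f" by simp
  have "f * (1 + (h - ln f)) \<le> f * exp (h - ln f)"
    using assms by (intro mult_left_mono exp_ge_add_one_self)
  then show ?thesis using \<open>0 < f\<close> by (simp add: exp_diff algebra_simps)
qed simp

text \<open>A Donsker-Varadhan type bound. Integrating the tangent inequality for the density
  \<open>f\<close> of \<open>P\<close> bounds the divergence below by
  \<open>\<integral> h dP + 1 - \<integral> exp h dQ\<close>, where the last two terms together are
  nonnegative.\<close>

lemma KL_div_ge:
  assumes "prob_space P" "sigma_finite_measure Q"
    and h: "integrable P h" "h \<in> borel_measurable Q" and e: "(\<integral>\<^sup>+x. ennreal (exp (h x)) \<partial>Q) \<le> 1"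
  shows "ereal (\<integral>x. h x \<partial>P) \<le> KL_div P Q"
proof (cases "KL_div P Q = \<infinity>")
  case False
  interpret P: prob_space P by fact
  interpret Q: sigma_finite_measure Q by fact
  define f where "f x = enn2real (RN_deriv Q P x)" for x
  have ac: "absolutely_continuous Q P" "sets P = sets Q" and int: "integrable Q (\<lambda>x. f x * ln (f x))"
    and KL: "KL_div P Q = ereal (\<integral>x. f x * ln (f x) \<partial>Q)"
    using False unfolding KL_div_def Let_def f_def by (auto split: if_splits)
  have [measurable]: "f \<in> borel_measurable Q" "h \<in> borel_measurable Q"
    using h by (auto simp: f_def[abs_def])
  have f0: "0 \<le> f x" for x by (simp add: f_def)
  have P: "P = density Q (\<lambda>x. ennreal (f x))"
  proof -
    have "P = density Q (RN_deriv Q P)" using Q.density_RN_deriv[OF ac] by simp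
    also have "\<dots> = density Q (\<lambda>x. ennreal (f x))"
      using Q.RN_deriv_finite[OF P.sigma_finite_measure_axioms ac]
      by (intro density_cong) (auto simp: f_def top.not_eq_extremum)
    finally show ?thesis .
  qed
  have fh: "integrable Q (\<lambda>x. f x * h x)"
    using h(1) by (subst (asm) P, subst (asm) integrable_real_density) (auto simp: f0)
  have fh': "(\<integral>x. h x \<partial>P) = (\<integral>x. f x * h x \<partial>Q)"
    by (subst P, subst integral_real_density) (auto simp: f0)
  have "emeasure P (space P) = (\<integral>\<^sup>+x. ennreal (f x) \<partial>Q)"
    using ac by (subst P) (simp add: emeasure_density cong: nn_integral_cong sets_eq_imp_space_eq)
  then have f1: "(\<integral>\<^sup>+x. ennreal (f x) \<partial>Q) = 1" using P.emeasure_space_1 by simp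
  have fi: "integrable Q f" by (rule integrableI_nonneg) (auto simp: f0 f1)
  have fI: "(\<integral>x. f x \<partial>Q) = 1" using f1 by (simp add: integral_eq_nn_integral f0)
  have ei: "integrable Q (\<lambda>x. exp (h x))"
    by (rule integrableI_nonneg) (auto intro: le_less_trans[OF e])
  have eI: "(\<integral>x. exp (h x) \<partial>Q) \<le> 1"
    using e by (simp add: integral_eq_nn_integral enn2real_leI)
  have "(\<integral>x. f x * h x + f x - exp (h x) \<partial>Q) \<le> (\<integral>x. f x * ln (f x) \<partial>Q)"
    by (intro integral_mono int Bochner_Integration.integrable_add Bochner_Integration.integrable_diff fh fi ei mult_ln_ge_tangent f0)
  then show ?thesis using fh fi ei fI eI by (simp add: KL fh')
qed simp

text \<open>The equality case of \<open>KL_div_ge\<close>, used to evaluate the divergences of the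
  Gaussian coupling. Almost-everywhere uniqueness lets the given density replace the derivative
  chosen in \<open>KL_div\<close>.\<close>

lemma KL_div_density_exp:
  assumes "sigma_finite_measure Q" and [measurable]: "h \<in> borel_measurable Q"
    and P: "P = density Q (\<lambda>x. ennreal (exp (h x)))" and h: "integrable P h"
  shows "KL_div P Q = ereal (\<integral>x. h x \<partial>P)"
proof -
  interpret Q: sigma_finite_measure Q by fact
  define f where "f x = enn2real (RN_deriv Q P x)" for x
  have [measurable]: "f \<in> borel_measurable Q" by (simp add: f_def[abs_def])
  have "AE x in Q. ennreal (exp (h x)) = RN_deriv Q P x"
    by (intro Q.RN_deriv_unique) (auto simp: P)
  then have ae: "AE x in Q. f x * ln (f x) = exp (h x) * h x"
    by (rule AE_mp) (auto intro!: AE_I2 simp: f_def enn2real_ennreal dest: sym)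
  have "absolutely_continuous Q P" "sets P = sets Q"
    unfolding P by (auto intro!: absolutely_continuousI_density)
  moreover have "integrable Q (\<lambda>x. exp (h x) * h x)"
    using h unfolding P by (subst (asm) integrable_real_density) auto
  then have "integrable Q (\<lambda>x. f x * ln (f x))"
    by (subst integrable_cong_AE[OF _ _ ae]) auto
  moreover have "(\<integral>x. f x * ln (f x) \<partial>Q) = (\<integral>x. h x \<partial>P)"
    unfolding P by (subst integral_real_density, auto intro!: integral_cong_AE ae)
  ultimately show ?thesis by (simp add: KL_div_def Let_def f_def)
qed

section \<open>Product Gaussian densities\<close>

text \<open>The entries of \<open>v\<close> are variances, while \<open>normal_density\<close>
  expects a standard deviation.\<close>

definition gauss_dens :: "real^'n \<Rightarrow> real^'n \<Rightarrow> real" where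
  "gauss_dens v x = (\<Prod>l\<in>UNIV. normal_density 0 (sqrt (v $ l)) (x $ l))"

lemma gauss_dens_pos: "(\<And>l. 0 < v $ l) \<Longrightarrow> 0 < gauss_dens v x"
  unfolding gauss_dens_def by (intro prod_pos ballI normal_density_pos) simp

lemma gauss_dens_nonneg [simp]: "0 \<le> gauss_dens v x"
  unfolding gauss_dens_def by (intro prod_nonneg ballI normal_density_nonneg)

lemma borel_measurable_vec_nth [measurable]: "(\<lambda>x::real^'n. x $ i) \<in> borel_measurable borel"
  by (intro borel_measurable_continuous_onI continuous_intros)

lemma borel_measurable_gauss_dens [measurable]: "gauss_dens v \<in> borel_measurable borel"
  unfolding gauss_dens_def[abs_def] by measurable

text \<open>The product rule for \<open>lborel\<close> is indexed by \<open>Basis\<close>; the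
  bijection \<open>axis i 1\<close>, with inverse \<open>axis_index\<close>, reindexes it by
  coordinates.\<close>

lemma nn_integral_lborel_prod_vec:
  fixes g :: "'n::finite \<Rightarrow> real \<Rightarrow> ennreal"
  assumes [measurable]: "\<And>i. g i \<in> borel_measurable borel"
  shows "(\<integral>\<^sup>+x. (\<Prod>i\<in>UNIV. g i (x $ i)) \<partial>(lborel :: (real^'n) measure))
       = (\<Prod>i\<in>UNIV. \<integral>\<^sup>+t. g i t \<partial>lborel)"
proof -
  have B: "(Basis :: (real^'n) set) = range (\<lambda>i. axis i 1)" by (auto simp: Basis_vec_def)
  have inj: "inj (\<lambda>i::'n. axis i (1::real))" by (auto simp: inj_on_def axis_eq_axis)
  have r: "(\<Prod>b\<in>Basis. F (axis_index b) b) = (\<Prod>i\<in>UNIV. F i (axis i 1))"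
    for F :: "'n \<Rightarrow> real^'n \<Rightarrow> ennreal"
    unfolding B by (subst prod.reindex[OF inj]) (simp add: axis_index_axis)
  have "(\<integral>\<^sup>+x. (\<Prod>i\<in>UNIV. g i (x $ i)) \<partial>(lborel :: (real^'n) measure))
      = (\<integral>\<^sup>+x. (\<Prod>b\<in>(Basis :: (real^'n) set). g (axis_index b) (x \<bullet> b)) \<partial>lborel)"
  proof (rule nn_integral_cong)
    fix x :: "real^'n"
    show "(\<Prod>i\<in>UNIV. g i (x $ i)) = (\<Prod>b\<in>(Basis :: (real^'n) set). g (axis_index b) (x \<bullet> b))"
      by (simp only: r[of "\<lambda>i b. g i (x \<bullet> b)"] cart_eq_inner_axis)
  qed
  also have "\<dots> = (\<Prod>b\<in>(Basis :: (real^'n) set). \<integral>\<^sup>+t. g (axis_index b) t \<partial>lborel)"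
    by (intro nn_integral_lborel_prod) auto
  finally show ?thesis by (simp only: r[of "\<lambda>i b. \<integral>\<^sup>+t. g i t \<partial>lborel"])
qed

lemma nn_integral_normal_density:
  assumes "0 < s" shows "(\<integral>\<^sup>+t. ennreal (normal_density m s t) \<partial>lborel) = 1"
  using assms by (subst nn_integral_eq_integral) auto

lemma nn_integral_gauss_dens_coordinate:
  assumes v: "\<And>l. 0 < v $ l" and [measurable]: "f \<in> borel_measurable borel"
  shows "(\<integral>\<^sup>+x. ennreal (gauss_dens v x) * f (x $ k) \<partial>lborel)
       = (\<integral>\<^sup>+t. ennreal (normal_density 0 (sqrt (v $ k)) t) * f t \<partial>lborel)"
proof -
  define g where "g i t = ennreal (normal_density 0 (sqrt (v $ i)) t) * (if i = k then f t else 1)" for i t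
  have gk: "g k t = ennreal (normal_density 0 (sqrt (v $ k)) t) * f t" for t by (simp add: g_def)
  have gi: "i \<noteq> k \<Longrightarrow> g i t = ennreal (normal_density 0 (sqrt (v $ i)) t)" for i t by (simp add: g_def)
  have [measurable]: "g i \<in> borel_measurable borel" for i
    unfolding g_def[abs_def] by measurable
  have "ennreal (gauss_dens v x) * f (x $ k) = (\<Prod>i\<in>UNIV. g i (x $ i))" for x
    by (simp add: gauss_dens_def g_def prod.distrib prod_ennreal prod.delta)
  then have "(\<integral>\<^sup>+x. ennreal (gauss_dens v x) * f (x $ k) \<partial>lborel) = (\<Prod>i\<in>UNIV. \<integral>\<^sup>+t. g i t \<partial>lborel)"
    by (simp add: nn_integral_lborel_prod_vec)
  also have "\<dots> = (\<Prod>i\<in>UNIV. if i = k then \<integral>\<^sup>+t. g k t \<partial>lborel else 1)"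
    using v by (intro prod.cong refl) (auto simp: gi nn_integral_normal_density cong: nn_integral_cong)
  also have "\<dots> = (\<integral>\<^sup>+t. g k t \<partial>lborel)" by simp
  finally show ?thesis by (simp add: gk)
qed

lemma nn_integral_normal_density_square:
  assumes "0 < v"
  shows "(\<integral>\<^sup>+t. ennreal (normal_density 0 (sqrt v) t) * ennreal ((t + c)\<^sup>2) \<partial>lborel) = ennreal (v + c\<^sup>2)"
proof -
  let ?n = "normal_density 0 (sqrt v)"
  have s: "0 < sqrt v" using assms by simp
  have 0: "has_bochner_integral lborel ?n 1"
    using s by (simp add: has_bochner_integral_iff)
  have 1: "has_bochner_integral lborel (\<lambda>t. ?n t * t) 0"
    using normal_moment_nz_1[OF s] .
  have 2: "has_bochner_integral lborel (\<lambda>t. ?n t * t\<^sup>2) v"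
    using normal_moment_even[OF s, of 0 1] assms by (simp add: fact_numeral)
  have "has_bochner_integral lborel (\<lambda>t. ?n t * t\<^sup>2 + (?n t * t) * (2 * c) + ?n t * c\<^sup>2) (v + 0 * (2 * c) + 1 * c\<^sup>2)"
    by (intro has_bochner_integral_add has_bochner_integral_mult_left 0 1 2)
  then have "has_bochner_integral lborel (\<lambda>t. ?n t * (t + c)\<^sup>2) (v + c\<^sup>2)"
    by (simp add: power2_eq_square algebra_simps)
  then have "(\<integral>\<^sup>+t. ennreal (?n t * (t + c)\<^sup>2) \<partial>lborel) = ennreal (v + c\<^sup>2)"
    by (subst nn_integral_eq_integral) (auto simp: has_bochner_integral_iff)
  then show ?thesis by (simp add: ennreal_mult)
qed

lemma normal_density_sqrt:
  assumes "0 < v"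
  shows "normal_density 0 (sqrt v) t = (2 * pi) powr (-1/2) * v powr (-1/2) * exp (- t\<^sup>2 / (2 * v))"
proof -
  have "1 / sqrt (2 * pi * v) = (2 * pi * v) powr (-1/2)"
    using assms by (simp add: powr_minus_divide powr_half_sqrt)
  also have "\<dots> = (2 * pi) powr (-1/2) * v powr (-1/2)"
    using assms by (subst powr_mult) auto
  finally show ?thesis using assms by (simp add: normal_density_def)
qed

lemma ln_gauss_dens:
  fixes v :: "real^'n"
  assumes v: "\<And>l. 0 < v $ l"
  shows "ln (gauss_dens v x) = (\<Sum>l\<in>UNIV. - ln (2 * pi * v $ l) / 2 - (x $ l)\<^sup>2 / (2 * v $ l))"
proof -
  have "ln (gauss_dens v x) = (\<Sum>l\<in>UNIV. ln (normal_density 0 (sqrt (v $ l)) (x $ l)))"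
    unfolding gauss_dens_def using v
    by (intro ln_prod normal_density_pos) (auto simp: less_imp_neq[symmetric] normal_density_pos)
  also have "\<dots> = (\<Sum>l\<in>UNIV. - ln (2 * pi * v $ l) / 2 - (x $ l)\<^sup>2 / (2 * v $ l))"
  proof (rule sum.cong)
    fix l
    show "ln (normal_density 0 (sqrt (v $ l)) (x $ l)) = - ln (2 * pi * v $ l) / 2 - (x $ l)\<^sup>2 / (2 * v $ l)"
      using v[of l] by (simp add: normal_density_sqrt ln_mult ln_powr field_simps)
  qed simp
  finally show ?thesis .
qed

section \<open>Gaussian vectors in eigen-coordinates\<close>

lemma matrix_inv_eqI:
  fixes A B :: "real^'n^'n"
  assumes "A ** B = mat 1" "B ** A = mat 1"
  shows "matrix_inv A = B"
proof -
  have "A ** matrix_inv A = mat 1 \<and> matrix_inv A ** A = mat 1"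
    unfolding matrix_inv_def by (rule someI[of _ B]) (use assms in simp)
  then show ?thesis by (metis assms(2) matrix_mul_assoc matrix_mul_lid matrix_mul_rid)
qed

lemma diag_mat_mult_vec: "diag_mat v *v x = (\<chi> l. v $ l * x $ l)"
  by (simp add: vec_eq_iff diag_mat_def matrix_vector_mult_def if_distrib if_distribR cong: if_cong)

text \<open>In the coordinates \<open>\<Theta> *v x\<close> the quadratic form is a weighted sum of
  squares and the determinant is the product of the eigenvalues, so the density factorises.\<close>

lemma gaussian_vec_eq:
  fixes \<Theta> :: "real^'n^'n" and lam :: "real^'n"
  assumes \<Theta>: "orthogonal_matrix \<Theta>" and lam: "\<And>l. 0 < lam $ l"
  shows "gaussian_vec (transpose \<Theta> ** diag_mat lam ** \<Theta>)
       = density lborel (\<lambda>x. ennreal (gauss_dens lam (\<Theta> *v x)))"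
proof -
  let ?S = "transpose \<Theta> ** diag_mat lam ** \<Theta>"
  define il where "il = (\<chi> l. inverse (lam $ l))"
  have o: "transpose \<Theta> ** \<Theta> = mat 1" "\<Theta> ** transpose \<Theta> = mat 1"
    using \<Theta> by (auto simp: orthogonal_matrix_def)
  have d: "diag_mat lam ** diag_mat il = mat 1" "diag_mat il ** diag_mat lam = mat 1"
    using lam by (auto simp: matrix_eq matrix_vector_mul_assoc[symmetric] diag_mat_mult_vec il_def vec_eq_iff less_imp_neq[symmetric])
  have inv: "matrix_inv ?S = transpose \<Theta> ** diag_mat il ** \<Theta>"
  proof (rule matrix_inv_eqI)
    show "?S ** (transpose \<Theta> ** diag_mat il ** \<Theta>) = mat 1"
      by (metis d(1) o matrix_mul_assoc matrix_mul_rid)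
    show "(transpose \<Theta> ** diag_mat il ** \<Theta>) ** ?S = mat 1"
      by (metis d(2) o matrix_mul_assoc matrix_mul_rid)
  qed
  have "det (transpose \<Theta>) * det \<Theta> = 1"
    using o(1) by (metis det_I det_mul)
  moreover have "det (diag_mat lam) = (\<Prod>l\<in>UNIV. lam $ l)"
    by (subst det_diagonal) (auto simp: diag_mat_def)
  ultimately have det: "det ?S = (\<Prod>l\<in>UNIV. lam $ l)" by (simp add: det_mul)
  have q: "x \<bullet> (matrix_inv ?S *v x) = (\<Sum>l\<in>UNIV. ((\<Theta> *v x) $ l)\<^sup>2 / lam $ l)" for x
  proof -
    have "x \<bullet> (matrix_inv ?S *v x) = (\<Theta> *v x) \<bullet> (diag_mat il *v (\<Theta> *v x))"
      unfolding inv matrix_vector_mul_assoc[symmetric]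
      by (metis dot_lmul_matrix vector_transpose_matrix)
    then show ?thesis
      by (simp add: diag_mat_mult_vec il_def inner_vec_def power2_eq_square divide_inverse mult_ac)
  qed
  have "(2 * pi) powr (- real CARD('n) / 2) * det ?S powr (-1/2) * exp (- (x \<bullet> (matrix_inv ?S *v x)) / 2)
      = gauss_dens lam (\<Theta> *v x)" for x
  proof -
    have "gauss_dens lam (\<Theta> *v x) = ((2 * pi) powr (-1/2)) ^ CARD('n)
        * (\<Prod>l\<in>UNIV. lam $ l powr (-1/2)) * exp (\<Sum>l\<in>UNIV. - ((\<Theta> *v x) $ l)\<^sup>2 / (2 * lam $ l))"
      unfolding gauss_dens_def using lam by (simp add: normal_density_sqrt prod.distrib exp_sum)
    also have "((2 * pi) powr (-1/2)) ^ CARD('n) = (2 * pi) powr (- real CARD('n) / 2)"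
      by (simp add: powr_realpow[symmetric] powr_powr)
    also have "(\<Prod>l\<in>UNIV. lam $ l powr (-1/2)) = det ?S powr (-1/2)"
      unfolding det by (rule prod_powr_distrib[symmetric])
    also have "(\<Sum>l\<in>UNIV. - ((\<Theta> *v x) $ l)\<^sup>2 / (2 * lam $ l)) = - (x \<bullet> (matrix_inv ?S *v x)) / 2"
      unfolding q by (simp add: sum_negf[symmetric] sum_divide_distrib mult.commute)
    finally show ?thesis ..
  qed
  then show ?thesis by (simp add: gaussian_vec_def)
qed

text \<open>Bayes' rule for a linear Gaussian pair: if \<open>w\<close> has variance
  \<open>h\<close> and \<open>y\<close> given \<open>w\<close> is \<open>N(a w, g)\<close>, then
  \<open>y\<close> has variance \<open>v\<close> and \<open>w\<close> given \<open>y\<close> is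
  \<open>N(a h y / v, h g / v)\<close>. It later identifies the source marginal of the
  coupling.\<close>

lemma normal_density_bayes:
  fixes a g h v y w :: real
  assumes "0 < g" "0 < h" "0 < v" and v: "a\<^sup>2 * h + g = v"
  shows "normal_density 0 (sqrt g) (y - a * w) * normal_density 0 (sqrt h) w
       = normal_density 0 (sqrt v) y * normal_density 0 (sqrt (h * g / v)) (w - a * h / v * y)"
proof -
  \<comment> \<open>Completing the square in \<open>w\<close>; the relation for \<open>v\<close>
    then matches the coefficients of \<open>y^2\<close> and \<open>w^2\<close>.\<close>
  have q: "(y - a * w)\<^sup>2 / (2 * g) + w\<^sup>2 / (2 * h)
      = y\<^sup>2 / (2 * v) + (w - a * h / v * y)\<^sup>2 / (2 * (h * g / v))"
  proof -
    have "y\<^sup>2 / (2 * v) + (w - a * h / v * y)\<^sup>2 / (2 * (h * g / v))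
        = ((a\<^sup>2 * h + g) * h * y\<^sup>2 / v + v * w\<^sup>2 - 2 * a * h * y * w) / (2 * h * g)"
      using assms(1-3) by (simp add: divide_simps) (simp add: power2_eq_square algebra_simps)
    also have "\<dots> = (h * y\<^sup>2 + (a\<^sup>2 * h + g) * w\<^sup>2 - 2 * a * h * y * w) / (2 * h * g)"
      using assms(3) by (simp add: v)
    also have "\<dots> = (y - a * w)\<^sup>2 / (2 * g) + w\<^sup>2 / (2 * h)"
      using assms(1-3) by (simp add: divide_simps) (simp add: power2_eq_square algebra_simps)
    finally show ?thesis ..
  qed
  have "g powr (-1/2) * h powr (-1/2) = (g * h) powr (-1/2)"
    using assms by (simp add: powr_mult)
  also have "g * h = v * (h * g / v)" using assms by simp
  also have "\<dots> powr (-1/2) = v powr (-1/2) * (h * g / v) powr (-1/2)"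
    using assms by (subst powr_mult) auto
  finally have p: "g powr (-1/2) * h powr (-1/2) = v powr (-1/2) * (h * g / v) powr (-1/2)" .
  have e: "(k * p * exp (- A / B)) * (k * r * exp (- C / E)) = k\<^sup>2 * (p * r) * exp (- (A / B + C / E))"
    for k p r A B C E :: real
  proof -
    have "- (A / B + C / E) = - A / B + - C / E" by simp
    then show ?thesis by (simp only: exp_add power2_eq_square mult_ac)
  qed
  have "0 < h * g / v" using assms(1-3) by simp
  then show ?thesis
    by (simp only: normal_density_sqrt[OF \<open>0 < g\<close>] normal_density_sqrt[OF \<open>0 < h\<close>]
        normal_density_sqrt[OF \<open>0 < v\<close>] normal_density_sqrt e p q)
qed

section \<open>The finite-dimensional problem\<close>

text \<open>\<open>P_l\<close> is infinite at \<open>0\<close>, so a finite budget forces every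
  \<open>lh $ l\<close> to be positive and the constraint becomes one between reals.\<close>

lemma rdp_feasible_iff:
  fixes lam :: "real^'n"
  shows "rdp_feasible lam D P lh g \<longleftrightarrow> (\<forall>l. 0 < g $ l \<and> g $ l \<le> lam $ l \<and> 0 < lh $ l)
     \<and> (\<Sum>l\<in>UNIV. D_l (lam $ l) (g $ l) (lh $ l)) \<le> D
     \<and> (\<Sum>l\<in>UNIV. (lh $ l / lam $ l - 1 + ln (lam $ l / lh $ l)) / 2) \<le> P" (is "_ \<longleftrightarrow> ?R")
proof
  assume *: "rdp_feasible lam D P lh g"
  then have "(\<Sum>l\<in>UNIV. P_l (lam $ l) (lh $ l)) \<noteq> \<infinity>"
    unfolding rdp_feasible_def by auto
  then have lh: "lh $ l \<noteq> 0" for l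
    by (auto simp: sum_Pinfty P_l_def dest: spec[of _ l])
  then have "P_l (lam $ l) (lh $ l) = ereal ((lh $ l / lam $ l - 1 + ln (lam $ l / lh $ l)) / 2)" for l
    by (simp add: P_l_def)
  then show ?R using * lh by (simp add: rdp_feasible_def less_le)
next
  assume *: ?R
  then have "P_l (lam $ l) (lh $ l) = ereal ((lh $ l / lam $ l - 1 + ln (lam $ l / lh $ l)) / 2)" for l
    by (simp add: P_l_def less_imp_neq[symmetric])
  then show "rdp_feasible lam D P lh g" using * by (simp add: rdp_feasible_def less_imp_le)
qed

lemma kl_term_nonneg:
  assumes "0 < (x::real)" "0 < v"
  shows "0 \<le> (x / v - 1 + ln (v / x)) / 2"
  using ln_le_minus_one[of "x / v"] assms by (simp add: ln_div)

text \<open>With \<open>u = x / v\<close> the hypothesis is \<open>u - 1 - ln u \<le> 2 * P\<close>.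
  Dropping the positive \<open>u\<close> gives the lower bound; \<open>ln u \<le> u / 2\<close>,
  from the tangent of \<open>ln\<close> at \<open>2\<close> and \<open>ln 2 \<le> 1\<close>, gives
  the upper one.\<close>

lemma kl_term_le_imp:
  assumes x: "0 < (x::real)" "0 < v" and le: "(x / v - 1 + ln (v / x)) / 2 \<le> P"
  shows "v * exp (- (2 * P + 1)) \<le> x" and "x \<le> v * (4 * P + 2)"
proof -
  define u where "u = x / v"
  have u: "0 < u" using x by (simp add: u_def)
  have le: "u - 1 - ln u \<le> 2 * P" using le x by (simp add: u_def ln_div)
  have "- (2 * P + 1) \<le> ln u" using le u by simp
  then have "exp (- (2 * P + 1)) \<le> u" using u by (simp add: ln_ge_iff)
  then show "v * exp (- (2 * P + 1)) \<le> x" using x by (simp add: u_def field_simps)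
  have "ln (u / 2) \<le> u / 2 - 1" using u by (intro ln_le_minus_one) simp
  moreover have "ln (2::real) \<le> 1" using ln_le_minus_one[of "2::real"] by simp
  ultimately have "u \<le> 4 * P + 2" using le u by (simp add: ln_div)
  then show "x \<le> v * (4 * P + 2)" using x by (simp add: u_def field_simps)
qed

text \<open>An explicit feasible point gives a value \<open>C\<close>. Feasible points with
  objective at most \<open>C\<close> lie in a box bounded away from \<open>0\<close>, where
  constraints and objective are continuous.\<close>

lemma rdp_minimizer_exists:
  fixes lam :: "real^'n"
  assumes lam: "\<And>l. 0 < lam $ l" and D: "0 < D" and P: "0 \<le> P"
  shows "\<exists>lh g. rdp_feasible lam D P lh g
     \<and> (\<forall>lh' g'. rdp_feasible lam D P lh' g' \<longrightarrow> rdp_obj lam g \<le> rdp_obj lam g')"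
proof -
  define S where "S = (\<Sum>l\<in>UNIV. lam $ l)"
  have S: "0 < S" unfolding S_def using lam by (intro sum_pos) auto
  \<comment> \<open>With \<open>lh = lam\<close> the perception cost vanishes, and \<open>g0\<close>
    below gives coordinate \<open>l\<close> the distortion \<open>2 * t * lam $ l\<close>, so the
    total \<open>2 * t * S\<close> is at most \<open>D\<close>. The cap \<open>1/2\<close> keeps
    \<open>1 - t\<close> positive.\<close>
  define t where "t = min (1/2) (D / (2 * S))"
  have t: "0 < t" "t < 1" "2 * t * S \<le> D"
    using S D by (auto simp: t_def min_def field_simps)
  define g0 where "g0 = (\<chi> l. lam $ l * (1 - (1 - t)\<^sup>2))"
  have g0_pos: "0 < g0 $ l" and g0_le: "g0 $ l \<le> lam $ l" for l
  proof -
    have "(1 - t)\<^sup>2 < 1" using t by (simp add: power_less_one_iff)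
    then show "0 < g0 $ l" "g0 $ l \<le> lam $ l" using lam[of l] by (simp_all add: g0_def mult_le_cancel_left1)
  qed
  have "D_l (lam $ l) (g0 $ l) (lam $ l) = 2 * t * lam $ l" for l
  proof -
    have "lam $ l * (lam $ l - g0 $ l) = (lam $ l * (1 - t))\<^sup>2"
      by (simp add: g0_def power2_eq_square algebra_simps)
    then have "sqrt (lam $ l * (lam $ l - g0 $ l)) = lam $ l * (1 - t)"
      using lam[of l] t by simp
    then show ?thesis by (simp add: D_l_def algebra_simps)
  qed
  then have "(\<Sum>l\<in>UNIV. D_l (lam $ l) (g0 $ l) (lam $ l)) \<le> D"
    using t by (simp add: sum_distrib_left[symmetric] S_def)
  then have feas0: "rdp_feasible lam D P lam g0"
    using lam g0_pos g0_le P by (auto simp: rdp_feasible_iff less_imp_neq[symmetric])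
  define C where "C = rdp_obj lam g0"
  \<comment> \<open>\<open>lo\<close> and \<open>hi\<close> are the bounds of
    \<open>kl_term_le_imp\<close>. For objective at most \<open>C\<close>, \<open>e\<close> comes
    from \<open>ln (lam $ l / g $ l) \<le> 2 * C\<close>, since all terms of the objective are
    nonnegative.\<close>
  define lo hi e where "lo = (\<chi> l. lam $ l * exp (- (2 * P + 1)))"
    and "hi = (\<chi> l. lam $ l * (4 * P + 2))" and "e = (\<chi> l. lam $ l * exp (- (2 * C)))"
  define B where "B = cbox (lo, e) (hi, lam)"
  have memB: "p \<in> B \<longleftrightarrow> (\<forall>l. lo $ l \<le> fst p $ l \<and> fst p $ l \<le> hi $ l \<and> e $ l \<le> snd p $ l \<and> snd p $ l \<le> lam $ l)" for p
    by (cases p) (auto simp: B_def cbox_Pair_eq mem_box_cart)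
  have B_pos: "0 < fst p $ l" "0 < snd p $ l" if "p \<in> B" for p l
  proof -
    have "0 < lo $ l" "0 < e $ l" using lam[of l] by (simp_all add: lo_def e_def)
    then show "0 < fst p $ l" "0 < snd p $ l" using that by (auto simp: memB intro: less_le_trans)
  qed
  let ?D = "\<lambda>p. \<Sum>l\<in>UNIV. D_l (lam $ l) (snd p $ l) (fst p $ l)"
  let ?P = "\<lambda>p. \<Sum>l\<in>UNIV. (fst p $ l / lam $ l - 1 + ln (lam $ l / fst p $ l)) / 2"
  define K where "K = {p \<in> B. ?D p \<le> D} \<inter> {p \<in> B. ?P p \<le> P}"
  have feasK: "p \<in> K \<longleftrightarrow> p \<in> B \<and> rdp_feasible lam D P (fst p) (snd p)" for p
    using B_pos[of p] by (auto simp: K_def rdp_feasible_iff memB)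
  have ln_nonneg: "0 \<le> ln (lam $ l / g $ l)" if "0 < g $ l" "g $ l \<le> lam $ l" for g :: "real^'n" and l
    using that by (intro ln_ge_zero) simp
  have inB: "(lh, g) \<in> B" if f: "rdp_feasible lam D P lh g" and le: "rdp_obj lam g \<le> C" for lh g
    unfolding memB
  proof (rule allI)
    fix l
    have *: "0 < g $ l" "g $ l \<le> lam $ l" "0 < lh $ l" for l using f by (auto simp: rdp_feasible_iff)
    have "(lh $ l / lam $ l - 1 + ln (lam $ l / lh $ l)) / 2 \<le> ?P (lh, g)"
      unfolding fst_conv using * lam by (intro member_le_sum kl_term_nonneg) auto
    also have "\<dots> \<le> P" using f by (simp add: rdp_feasible_iff)
    finally have 1: "(lh $ l / lam $ l - 1 + ln (lam $ l / lh $ l)) / 2 \<le> P" .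
    have "ln (lam $ l / g $ l) \<le> (\<Sum>l\<in>UNIV. ln (lam $ l / g $ l))"
      using * by (intro member_le_sum ln_nonneg) auto
    also have "\<dots> \<le> 2 * C" using le by (simp add: rdp_obj_def)
    finally have "- (2 * C) \<le> ln (g $ l / lam $ l)" using *[of l] lam[of l] by (simp add: ln_div)
    then have "exp (- (2 * C)) \<le> g $ l / lam $ l" using *[of l] lam[of l] by (simp add: ln_ge_iff)
    then have 2: "lam $ l * exp (- (2 * C)) \<le> g $ l" using lam[of l] by (simp add: field_simps)
    show "lo $ l \<le> fst (lh, g) $ l \<and> fst (lh, g) $ l \<le> hi $ l \<and> e $ l \<le> snd (lh, g) $ l \<and> snd (lh, g) $ l \<le> lam $ l"
      using kl_term_le_imp[OF *(3)[of l] lam 1] 2 *[of l] by (simp add: lo_def hi_def e_def)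
  qed
  have ne: "p \<in> B \<Longrightarrow> fst p $ l \<noteq> 0" "p \<in> B \<Longrightarrow> snd p $ l \<noteq> 0" "lam $ l \<noteq> 0" for p l
    using B_pos[of p l] lam[of l] by auto
  have cD: "continuous_on B ?D"
    unfolding D_l_def by (intro continuous_intros)
  have cP: "continuous_on B ?P"
    by (intro continuous_intros) (auto simp: ne)
  have cO: "continuous_on B (\<lambda>p. rdp_obj lam (snd p))"
    unfolding rdp_obj_def by (intro continuous_intros) (auto simp: ne)
  have clB: "closed B" "compact B" by (simp_all add: B_def compact_cbox closed_cbox)
  have "K = B \<inter> ({p \<in> B. ?D p \<le> D} \<inter> {p \<in> B. ?P p \<le> P})"
    by (auto simp: K_def)
  then have K: "compact K"
    using continuous_on_closed_Collect_le[OF cD continuous_on_const clB(1)]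
      continuous_on_closed_Collect_le[OF cP continuous_on_const clB(1)] clB(2)
    by (simp only:) (intro compact_Int_closed closed_Int)
  have K0: "(lam, g0) \<in> K" unfolding feasK using feas0 inB[OF feas0] by (simp add: C_def)
  have "continuous_on K (\<lambda>p. rdp_obj lam (snd p))"
    by (rule continuous_on_subset[OF cO]) (auto simp: K_def)
  then obtain p where p: "p \<in> K" and min: "\<And>q. q \<in> K \<Longrightarrow> rdp_obj lam (snd p) \<le> rdp_obj lam (snd q)"
    using continuous_attains_inf[OF K] K0 by blast
  \<comment> \<open>Feasible points with value above \<open>C\<close> are beaten by
    \<open>(lam, g0)\<close>, which lies in \<open>K\<close>.\<close>
  have "rdp_obj lam (snd p) \<le> rdp_obj lam g" if f: "rdp_feasible lam D P lh g" for lh g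
  proof (cases "rdp_obj lam g \<le> C")
    case True
    then show ?thesis using min[of "(lh, g)"] inB[OF f] f by (simp add: feasK)
  next
    case False
    then show ?thesis using min[OF K0] by (simp add: C_def)
  qed
  then show ?thesis using p by (auto simp: feasK)
qed

section \<open>Gaussian test functions and the lower bound\<close>

text \<open>Supplies the small variances that rule out degenerate second moments; the chosen
  \<open>t\<close> gives the value \<open>C + 1/2\<close>.\<close>

lemma ln_div_half_unbounded:
  assumes "0 < (x::real)" obtains t where "0 < t" "C < ln (x / t) / 2"
proof
  show "0 < x * exp (- (2 * C + 1))" "C < ln (x / (x * exp (- (2 * C + 1)))) / 2"
    using assms by (simp_all add: ln_div ln_mult)
qed

text \<open>\<open>T\<close> is the passage to eigen-coordinates; keeping it an abstract orthogonal
  map confines the matrices to \<open>gaussian_vec_eq\<close>.\<close>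

locale gaussian_source =
  fixes T :: "real^'n \<Rightarrow> real^'n" and lam :: "real^'n"
  assumes orth: "orthogonal_transformation T" and lam_pos: "0 < lam $ l"
begin

text \<open>For positive \<open>v\<close>, the law of a vector whose image under \<open>T\<close> is
  centred Gaussian with independent coordinates of variances \<open>v\<close>. Both marginals of the
  optimal coupling have this form.\<close>

definition G :: "real^'n \<Rightarrow> (real^'n) measure" where
  "G v = density lborel (\<lambda>x. ennreal (gauss_dens v (T x)))"

definition scaled :: "real^'n \<Rightarrow> real^'n \<Rightarrow> real^'n" where
  "scaled a w = (\<chi> l. a $ l * T w $ l)"

text \<open>The log-likelihood ratio of the backward channel \<open>T x \<sim> N(a * T w, diag g)\<close> against the source.\<close>

definition llr :: "real^'n \<Rightarrow> real^'n \<Rightarrow> real^'n \<Rightarrow> real^'n \<Rightarrow> real" where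
  "llr g a x w = ln (gauss_dens g (T x - scaled a w)) - ln (gauss_dens lam (T x))"

section \<open>Integrals of rotated Gaussian densities\<close>

lemma T_measurable [measurable]: "T \<in> borel_measurable borel"
  using orthogonal_transformation_linear[OF orth]
  by (intro borel_measurable_continuous_onI linear_continuous_on linear_conv_bounded_linear[THEN iffD1])

lemma norm_square_T: "(norm (x - w))\<^sup>2 = (\<Sum>l\<in>UNIV. (T x $ l - T w $ l)\<^sup>2)"
proof -
  have "norm (x - w) = norm (T x - T w)"
    using orthogonal_transformation_norm[OF orth, of "x - w"]
    by (simp add: linear_diff[OF orthogonal_transformation_linear[OF orth]])
  then show ?thesis by (simp only: power2_norm_eq_inner inner_vec_def) (simp add: power2_eq_square)
qed

lemma scaled_nth [simp]: "scaled a w $ l = a $ l * T w $ l"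
  by (simp add: scaled_def)

lemma sets_G [simp, measurable_cong]: "sets (G v) = sets borel" by (simp add: G_def)

lemma space_G [simp]: "space (G v) = UNIV" by (simp add: G_def)

text \<open>The factors \<open>2 * pi\<close> cancel and what remains is quadratic in the
  coordinates, so its expectation depends on second moments only.\<close>

lemma llr_eq:
  assumes g: "\<And>l. 0 < g $ l"
  shows "llr g a x w = (\<Sum>l\<in>UNIV. ln (lam $ l / g $ l) / 2 + (T x $ l)\<^sup>2 / (2 * lam $ l)
           - (T x $ l - a $ l * T w $ l)\<^sup>2 / (2 * g $ l))"
proof -
  have "- ln (2 * pi * g $ l) / 2 - (T x - scaled a w) $ l ^ 2 / (2 * g $ l)
      - (- ln (2 * pi * lam $ l) / 2 - (T x $ l)\<^sup>2 / (2 * lam $ l))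
      = ln (lam $ l / g $ l) / 2 + (T x $ l)\<^sup>2 / (2 * lam $ l)
        - (T x $ l - a $ l * T w $ l)\<^sup>2 / (2 * g $ l)" for l
    using g[of l] lam_pos[of l] by (simp add: ln_mult ln_div diff_divide_distrib add_divide_distrib)
  then show ?thesis
    by (simp only: llr_def ln_gauss_dens[OF g] ln_gauss_dens[OF lam_pos] sum_subtractf[symmetric])
qed

lemma llr_measurable:
  assumes [simp]: "\<And>l. 0 < g $ l"
  shows "(\<lambda>z. llr g a (fst z) (snd z)) \<in> borel_measurable (borel \<Otimes>\<^sub>M borel)"
    and "(\<lambda>x. llr g a x w) \<in> borel_measurable borel"
    and "(\<lambda>w. llr g a x w) \<in> borel_measurable borel"
  by (simp_all add: llr_eq)

lemma exp_llr:
  assumes g: "\<And>l. 0 < g $ l"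
  shows "exp (llr g a x w) = gauss_dens g (T x - scaled a w) / gauss_dens lam (T x)"
  unfolding llr_def exp_diff using g lam_pos by (simp add: gauss_dens_pos)

text \<open>Rotation invariance removes \<open>T\<close>, translation removes \<open>c\<close>, and
  the marginal of coordinate \<open>k\<close> remains.\<close>

lemma nn_integral_gauss_dens_shift:
  assumes v: "\<And>l. 0 < v $ l" and [measurable]: "f \<in> borel_measurable borel"
  shows "(\<integral>\<^sup>+x. ennreal (gauss_dens v (T x - c)) * f (T x $ k) \<partial>lborel)
       = (\<integral>\<^sup>+t. ennreal (normal_density 0 (sqrt (v $ k)) t) * f (t + c $ k) \<partial>lborel)"
proof -
  have "(\<integral>\<^sup>+x. ennreal (gauss_dens v (T x - c)) * f (T x $ k) \<partial>lborel)
      = (\<integral>\<^sup>+x. ennreal (gauss_dens v (x - c)) * f (x $ k) \<partial>lborel)"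
    by (rule nn_integral_lborel_orthogonal_transformation[OF orth]) measurable
  also have "\<dots> = (\<integral>\<^sup>+x. ennreal (gauss_dens v x) * f (x $ k + c $ k) \<partial>lborel)"
    by (subst nn_integral_lborel_translate[symmetric, where c=c]) simp_all
  also have "\<dots> = (\<integral>\<^sup>+t. ennreal (normal_density 0 (sqrt (v $ k)) t) * f (t + c $ k) \<partial>lborel)"
    by (rule nn_integral_gauss_dens_coordinate[OF v, of "\<lambda>t. f (t + c $ k)"]) measurable
  finally show ?thesis .
qed

lemma nn_integral_gauss_dens_shift_1:
  assumes v: "\<And>l. 0 < v $ l"
  shows "(\<integral>\<^sup>+x. ennreal (gauss_dens v (T x - c)) \<partial>lborel) = 1"
  using nn_integral_gauss_dens_shift[OF v, of "\<lambda>_. 1" c] v by (simp add: nn_integral_normal_density)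

lemma nn_integral_gauss_dens_shift_square:
  assumes v: "\<And>l. 0 < v $ l"
  shows "(\<integral>\<^sup>+x. ennreal (gauss_dens v (T x - c)) * ennreal ((T x $ k - s)\<^sup>2) \<partial>lborel)
       = ennreal (v $ k + (c $ k - s)\<^sup>2)"
  using nn_integral_gauss_dens_shift[OF v, of "\<lambda>t. ennreal ((t - s)\<^sup>2)" c k] v
    nn_integral_normal_density_square[of "v $ k" "c $ k - s"]
  by (simp add: algebra_simps)

lemma prob_space_G:
  assumes v: "\<And>l. 0 < v $ l"
  shows "prob_space (G v)"
  by (rule prob_spaceI)
     (use nn_integral_gauss_dens_shift_1[OF v, of 0] in \<open>simp add: G_def emeasure_density\<close>)

lemma nn_integral_G_square:
  assumes v: "\<And>l. 0 < v $ l"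
  shows "(\<integral>\<^sup>+x. ennreal ((T x $ k)\<^sup>2) \<partial>G v) = ennreal (v $ k)"
  using nn_integral_gauss_dens_shift_square[OF v, of 0 k 0]
  by (simp add: G_def nn_integral_density)

lemma nn_integral_exp_llr:
  assumes g: "\<And>l. 0 < g $ l" and [measurable]: "F \<in> borel_measurable borel"
  shows "(\<integral>\<^sup>+x. ennreal (exp (llr g a x w)) * F x \<partial>G lam)
       = (\<integral>\<^sup>+x. ennreal (gauss_dens g (T x - scaled a w)) * F x \<partial>lborel)"
proof -
  have "ennreal (gauss_dens lam (T x)) * ennreal (exp (llr g a x w)) = ennreal (gauss_dens g (T x - scaled a w))" for x
    unfolding exp_llr[OF g] using gauss_dens_pos[of lam "T x", OF lam_pos]
    by (simp add: ennreal_mult''[symmetric])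
  moreover have [measurable]: "(\<lambda>x. llr g a x w) \<in> borel_measurable borel" using g by (rule llr_measurable)
  ultimately show ?thesis
    unfolding G_def by (subst nn_integral_density) (auto simp: mult.assoc[symmetric])
qed

lemma nn_integral_exp_llr_1:
  assumes g: "\<And>l. 0 < g $ l"
  shows "(\<integral>\<^sup>+x. ennreal (exp (llr g a x w)) \<partial>G lam) = 1"
  using nn_integral_exp_llr[OF g, of "\<lambda>_. 1" a w] nn_integral_gauss_dens_shift_1[OF g] by simp

text \<open>\<open>KL_div_ge\<close> with \<open>llr s 0 x 0\<close>, the log-likelihood ratio of
  \<open>G s\<close> against \<open>G lam\<close>. The variances \<open>s\<close> stay free, so that
  they can be set to \<open>m\<close> or shrunk towards \<open>0\<close> in one coordinate.\<close>

lemma KL_div_G_ge: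
  assumes \<nu>: "prob_space \<nu>" and [measurable_cong]: "sets \<nu> = sets borel"
    and int: "\<And>l. integrable \<nu> (\<lambda>w. (T w $ l)\<^sup>2)" and s: "\<And>l. 0 < s $ l"
  defines "m \<equiv> \<lambda>l. \<integral>w. (T w $ l)\<^sup>2 \<partial>\<nu>"
  shows "ereal (\<Sum>l\<in>UNIV. ln (lam $ l / s $ l) / 2 + m l / (2 * lam $ l) - m l / (2 * s $ l))
     \<le> KL_div \<nu> (G lam)"
proof -
  interpret \<nu>: prob_space \<nu> by fact
  interpret L: prob_space "G lam" by (rule prob_space_G[OF lam_pos])
  have [measurable]: "(\<lambda>x. llr s 0 x 0) \<in> borel_measurable borel" using s by (rule llr_measurable)
  have *: "has_bochner_integral \<nu> (\<lambda>x. llr s 0 x 0)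
     (\<Sum>l\<in>UNIV. ln (lam $ l / s $ l) / 2 + m l / (2 * lam $ l) - m l / (2 * s $ l))"
    unfolding llr_eq[OF s] m_def using int
    by (auto simp: has_bochner_integral_iff \<nu>.prob_space)
  show ?thesis
    using KL_div_ge[OF \<nu> L.sigma_finite_measure_axioms, of "\<lambda>x. llr s 0 x 0"] *
      nn_integral_exp_llr_1[OF s, of 0 0]
    by (simp add: has_bochner_integral_iff)
qed

text \<open>\<open>KL_div_ge\<close> with the log-likelihood ratio of a Gaussian backward channel,
  whose parameters \<open>a\<close> and \<open>g\<close> need not match
  \<open>\<mu>\<close>.\<close>

lemma mutual_info_ge:
  assumes \<mu>: "\<mu> \<in> couplings (G lam)" and g: "\<And>l. 0 < g $ l"
    and int: "\<And>l. integrable \<mu> (\<lambda>z. (T (fst z) $ l)\<^sup>2)"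
      "\<And>l. integrable \<mu> (\<lambda>z. (T (fst z) $ l - a $ l * T (snd z) $ l)\<^sup>2)"
  shows "ereal (\<Sum>l\<in>UNIV. ln (lam $ l / g $ l) / 2 + (\<integral>z. (T (fst z) $ l)\<^sup>2 \<partial>\<mu>) / (2 * lam $ l)
      - (\<integral>z. (T (fst z) $ l - a $ l * T (snd z) $ l)\<^sup>2 \<partial>\<mu>) / (2 * g $ l))
     \<le> mutual_info \<mu>"
proof -
  have "prob_space \<mu>" and [measurable_cong]: "sets \<mu> = sets (borel \<Otimes>\<^sub>M borel)"
    and fst: "distr \<mu> borel fst = G lam"
    using \<mu> by (auto simp: couplings_def)
  interpret \<mu>: prob_space \<mu> by fact
  interpret L: prob_space "G lam" by (rule prob_space_G[OF lam_pos])
  define N where "N = distr \<mu> borel snd"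
  have [measurable_cong]: "sets N = sets borel" by (simp add: N_def)
  interpret N: prob_space N unfolding N_def by (rule \<mu>.prob_space_distr) measurable
  interpret LN: pair_prob_space "G lam" N ..
  let ?h = "\<lambda>z. llr g a (fst z) (snd z)"
  have [measurable]: "?h \<in> borel_measurable (borel \<Otimes>\<^sub>M borel)" using g by (rule llr_measurable)
  have h: "?h \<in> borel_measurable (G lam \<Otimes>\<^sub>M N)" by measurable
  have *: "has_bochner_integral \<mu> ?h
     (\<Sum>l\<in>UNIV. ln (lam $ l / g $ l) / 2 + (\<integral>z. (T (fst z) $ l)\<^sup>2 \<partial>\<mu>) / (2 * lam $ l)
      - (\<integral>z. (T (fst z) $ l - a $ l * T (snd z) $ l)\<^sup>2 \<partial>\<mu>) / (2 * g $ l))"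
    unfolding llr_eq[OF g] using int
    by (auto simp: has_bochner_integral_iff \<mu>.prob_space)
  \<comment> \<open>For each fixed \<open>w\<close> the inner integral is \<open>1\<close>, whatever
    the law \<open>N\<close> of the reconstruction.\<close>
  have "(\<integral>\<^sup>+z. ennreal (exp (?h z)) \<partial>(G lam \<Otimes>\<^sub>M N))
      = (\<integral>\<^sup>+w. \<integral>\<^sup>+x. ennreal (exp (?h (x, w))) \<partial>G lam \<partial>N)"
    using h by (intro LN.nn_integral_snd[symmetric]) simp
  also have "\<dots> = 1" by (simp add: nn_integral_exp_llr_1[OF g] N.emeasure_space_1)
  finally have "(\<integral>\<^sup>+z. ennreal (exp (?h z)) \<partial>(G lam \<Otimes>\<^sub>M N)) \<le> 1" by simp
  then show ?thesis
    using KL_div_ge[OF \<open>prob_space \<mu>\<close> LN.P.sigma_finite_measure_axioms, of ?h] * h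
    by (simp add: has_bochner_integral_iff mutual_info_def fst N_def)
qed

text \<open>Reduces an arbitrary coupling to a feasible point that costs no more. Finite mutual
  information excludes a vanishing error \<open>g $ k\<close>, and finite \<open>P\<close> a
  vanishing \<open>m k\<close>.\<close>

lemma coupling_feasible_point:
  assumes \<mu>: "\<mu> \<in> couplings (G lam)" and D: "0 < D"
    and dist: "(\<integral>\<^sup>+ z. ennreal ((norm (fst z - snd z))\<^sup>2) \<partial>\<mu>) \<le> ennreal D"
    and KL: "KL_div (distr \<mu> borel snd) (G lam) \<le> ereal P"
    and fin: "mutual_info \<mu> \<noteq> \<infinity>"
  shows "\<exists>lh g. rdp_feasible lam D P lh g \<and> ereal (rdp_obj lam g) \<le> mutual_info \<mu>"
proof -
  have "prob_space \<mu>" and [measurable_cong]: "sets \<mu> = sets (borel \<Otimes>\<^sub>M borel)"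
    and fst: "distr \<mu> borel fst = G lam"
    using \<mu> by (auto simp: couplings_def)
  interpret \<mu>: prob_space \<mu> by fact
  define y where "y l z = T (fst z) $ l" for l and z :: "(real^'n) \<times> (real^'n)"
  define w where "w l z = T (snd z) $ l" for l and z :: "(real^'n) \<times> (real^'n)"
  have [measurable]: "y l \<in> borel_measurable \<mu>" "w l \<in> borel_measurable \<mu>" for l
    unfolding y_def[abs_def] w_def[abs_def] by measurable
  have nn_y: "(\<integral>\<^sup>+z. ennreal ((y l z)\<^sup>2) \<partial>\<mu>) = ennreal (lam $ l)" for l
  proof -
    have "(\<integral>\<^sup>+z. ennreal ((y l z)\<^sup>2) \<partial>\<mu>) = (\<integral>\<^sup>+x. ennreal ((T x $ l)\<^sup>2) \<partial>distr \<mu> borel fst)"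
      by (subst nn_integral_distr) (auto simp: y_def)
    then show ?thesis by (simp add: fst nn_integral_G_square lam_pos)
  qed
  have yy: "integrable \<mu> (\<lambda>z. (y l z)\<^sup>2)" for l
    by (rule integrableI_nonneg) (auto simp: nn_y)
  have Ey: "(\<integral>z. (y l z)\<^sup>2 \<partial>\<mu>) = lam $ l" for l
    using lam_pos[of l] by (subst integral_eq_nn_integral) (auto simp: nn_y)
  have nrm: "(norm (fst z - snd z))\<^sup>2 = (\<Sum>l\<in>UNIV. (y l z - w l z)\<^sup>2)" for z
    by (simp add: norm_square_T y_def w_def)
  have nn_d: "(\<integral>\<^sup>+z. ennreal (\<Sum>l\<in>UNIV. (y l z - w l z)\<^sup>2) \<partial>\<mu>) \<le> ennreal D"
    using dist by (simp add: nrm)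
  have dd: "integrable \<mu> (\<lambda>z. (y l z - w l z)\<^sup>2)" for l
  proof (rule integrableI_nonneg)
    have "(\<integral>\<^sup>+z. ennreal ((y l z - w l z)\<^sup>2) \<partial>\<mu>) \<le> ennreal D"
      by (rule order_trans[OF nn_integral_mono nn_d]) (auto intro!: ennreal_leI member_le_sum)
    then show "(\<integral>\<^sup>+z. ennreal ((y l z - w l z)\<^sup>2) \<partial>\<mu>) < \<infinity>"
      by (metis ennreal_less_top infinity_ennreal_def le_less_trans)
  qed auto
  have Ed: "(\<Sum>l\<in>UNIV. \<integral>z. (y l z - w l z)\<^sup>2 \<partial>\<mu>) \<le> D"
  proof -
    have "(\<Sum>l\<in>UNIV. \<integral>z. (y l z - w l z)\<^sup>2 \<partial>\<mu>) = (\<integral>z. (\<Sum>l\<in>UNIV. (y l z - w l z)\<^sup>2) \<partial>\<mu>)"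
      using dd by simp
    also have "\<dots> \<le> D"
      using nn_d D by (subst integral_eq_nn_integral) (auto intro!: enn2real_leI sum_nonneg)
    finally show ?thesis .
  qed
  \<comment> \<open>Since \<open>2 y^2 + 2 (y - w)^2 - w^2 = (2 y - w)^2\<close>, finite distortion
    passes square integrability from the source to the reconstruction.\<close>
  have ww: "integrable \<mu> (\<lambda>z. (w l z)\<^sup>2)" for l
  proof (rule Bochner_Integration.integrable_bound)
    show "integrable \<mu> (\<lambda>z. 2 * (y l z)\<^sup>2 + 2 * (y l z - w l z)\<^sup>2)" using yy dd by simp
    show "AE z in \<mu>. norm ((w l z)\<^sup>2) \<le> norm (2 * (y l z)\<^sup>2 + 2 * (y l z - w l z)\<^sup>2)"
    proof (rule AE_I2)
      fix z
      have "0 \<le> (2 * y l z - w l z)\<^sup>2" by simp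
      then show "norm ((w l z)\<^sup>2) \<le> norm (2 * (y l z)\<^sup>2 + 2 * (y l z - w l z)\<^sup>2)"
        by (simp add: power2_eq_square algebra_simps)
    qed
  qed simp
  have yw: "integrable \<mu> (\<lambda>z. y l z * w l z)" for l
  proof -
    have "integrable \<mu> (\<lambda>z. ((y l z)\<^sup>2 + (w l z)\<^sup>2 - (y l z - w l z)\<^sup>2) / 2)"
      using yy ww dd by simp
    then show ?thesis by (simp add: power2_eq_square algebra_simps)
  qed
  define m where "m l = (\<integral>z. (w l z)\<^sup>2 \<partial>\<mu>)" for l
  define c where "c l = (\<integral>z. y l z * w l z \<partial>\<mu>)" for l
  have e: "integrable \<mu> (\<lambda>z. (y l z - b * w l z)\<^sup>2)"
    "(\<integral>z. (y l z - b * w l z)\<^sup>2 \<partial>\<mu>) = lam $ l - 2 * b * c l + b\<^sup>2 * m l" for l b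
  proof -
    have *: "(y l z - b * w l z)\<^sup>2 = (y l z)\<^sup>2 - (2 * b) * (y l z * w l z) + b\<^sup>2 * (w l z)\<^sup>2" for z
      by (simp add: power2_eq_square algebra_simps)
    show "integrable \<mu> (\<lambda>z. (y l z - b * w l z)\<^sup>2)" unfolding * using yy ww yw by simp
    show "(\<integral>z. (y l z - b * w l z)\<^sup>2 \<partial>\<mu>) = lam $ l - 2 * b * c l + b\<^sup>2 * m l"
      unfolding * using yy[of l] ww[of l] yw[of l] by (simp add: Ey m_def c_def)
  qed
  define N where "N = distr \<mu> borel snd"
  have N: "prob_space N" "sets N = sets borel"
    unfolding N_def by (auto intro!: \<mu>.prob_space_distr)
  have wN: "integrable N (\<lambda>x. (T x $ l)\<^sup>2)" "(\<integral>x. (T x $ l)\<^sup>2 \<partial>N) = m l" for l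
    using ww[of l] by (auto simp: N_def integrable_distr_eq integral_distr m_def w_def)
  have KLb: "(\<Sum>l\<in>UNIV. ln (lam $ l / s $ l) / 2 + m l / (2 * lam $ l) - m l / (2 * s $ l)) \<le> P"
    if "\<And>l. 0 < s $ l" for s
    using order_trans[OF KL_div_G_ge[OF N wN(1) that] KL[folded N_def]] by (simp add: wN)
  obtain R where R: "mutual_info \<mu> = ereal R"
  proof -
    have "mutual_info \<mu> \<noteq> -\<infinity>" by (simp add: mutual_info_def KL_div_def Let_def)
    with fin show ?thesis using that by (cases "mutual_info \<mu>") auto
  qed
  have MIb: "(\<Sum>l\<in>UNIV. ln (lam $ l / g $ l) / 2 + lam $ l / (2 * lam $ l)
      - (lam $ l - 2 * a $ l * c l + (a $ l)\<^sup>2 * m l) / (2 * g $ l)) \<le> R"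
    if "\<And>l. 0 < g $ l" for g a
    using mutual_info_ge[OF \<mu> that, of a, folded y_def w_def, OF yy e(1)]
    by (simp add: Ey e(2) R)
  \<comment> \<open>Were \<open>m k = 0\<close>, the penalty \<open>m k / (2 * s $ k)\<close> would
    vanish for every \<open>s\<close>. With \<open>s = lam\<close> in the other coordinates only
    \<open>ln (lam $ k / t) / 2\<close> is left, which exceeds \<open>P\<close> for small
    \<open>t\<close>.\<close>
  have m_pos: "0 < m k" for k
  proof (rule ccontr)
    assume "\<not> 0 < m k"
    moreover have "0 \<le> m k" by (simp add: m_def)
    ultimately have m0: "m k = 0" by simp
    obtain t where t: "0 < t" "P < ln (lam $ k / t) / 2"
      using ln_div_half_unbounded[OF lam_pos] .
    define s where "s = (\<chi> l. if l = k then t else lam $ l)"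
    have "(\<Sum>l\<in>UNIV. ln (lam $ l / s $ l) / 2 + m l / (2 * lam $ l) - m l / (2 * s $ l))
        = (\<Sum>l\<in>UNIV. if l = k then ln (lam $ k / t) / 2 else 0)"
      using lam_pos by (intro sum.cong) (auto simp: s_def m0 less_imp_neq[symmetric])
    moreover have "0 < s $ l" for l using t lam_pos by (simp add: s_def)
    ultimately show False using KLb[of s] t by simp
  qed
  \<comment> \<open>The mean square error of the best linear estimate of \<open>y l\<close> from
    \<open>w l\<close>, whose coefficient is \<open>c l / m l\<close>.\<close>
  define g where "g = (\<chi> l. lam $ l - (c l)\<^sup>2 / m l)"
  have g_eq: "lam $ l - 2 * (c l / m l) * c l + (c l / m l)\<^sup>2 * m l = g $ l" for l
    using m_pos[of l] by (simp add: g_def power2_eq_square field_simps)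
  \<comment> \<open>As for \<open>m_pos\<close>: the test channel is informative in coordinate
    \<open>k\<close> only, with variance \<open>t\<close>. The other terms cancel, and with
    \<open>g $ k \<le> 0\<close> the bound would exceed \<open>R\<close>.\<close>
  have g_pos: "0 < g $ k" for k
  proof (rule ccontr)
    assume *: "\<not> 0 < g $ k"
    obtain t where t: "0 < t" "R < ln (lam $ k / t) / 2"
      using ln_div_half_unbounded[OF lam_pos] .
    define s where "s = (\<chi> l. if l = k then t else lam $ l)"
    define a where "a = (\<chi> l. if l = k then c l / m l else 0)"
    have "(\<Sum>l\<in>UNIV. ln (lam $ l / s $ l) / 2 + lam $ l / (2 * lam $ l)
      - (lam $ l - 2 * a $ l * c l + (a $ l)\<^sup>2 * m l) / (2 * s $ l))
        = (\<Sum>l\<in>UNIV. if l = k then ln (lam $ k / t) / 2 + 1 / 2 - g $ k / (2 * t) else 0)"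
      using lam_pos by (intro sum.cong) (auto simp: s_def a_def g_eq[simplified] less_imp_neq[symmetric])
    moreover have "0 < s $ l" for l using t lam_pos by (simp add: s_def)
    ultimately have "ln (lam $ k / t) / 2 + 1 / 2 - g $ k / (2 * t) \<le> R"
      using MIb[of s a] by simp
    moreover have "g $ k / (2 * t) \<le> 0" using * t by (simp add: divide_nonpos_pos)
    ultimately show False using t by simp
  qed
  have "rdp_feasible lam D P (\<chi> l. m l) g"
    unfolding rdp_feasible_def
  proof (intro conjI allI)
    fix l
    show "0 < g $ l" by (rule g_pos)
    show "g $ l \<le> lam $ l" using m_pos[of l] by (simp add: g_def)
    show "0 \<le> (\<chi> l. m l) $ l" using m_pos[of l] by simp
  next
    \<comment> \<open>The product under the root is \<open>(c l)^2\<close>, so the root is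
      \<open>\<bar>c l\<bar>\<close>. As \<open>c l \<le> \<bar>c l\<bar>\<close>,
      \<open>D_l\<close> does not exceed the actual distortion even for negative
      correlation.\<close>
    have "D_l (lam $ l) (g $ l) ((\<chi> l. m l) $ l) \<le> (\<integral>z. (y l z - w l z)\<^sup>2 \<partial>\<mu>)" for l
    proof -
      have "sqrt (m l * (lam $ l - g $ l)) = \<bar>c l\<bar>"
        using m_pos[of l] by (simp add: g_def)
      then show ?thesis using e(2)[of l 1] by (simp add: D_l_def)
    qed
    then show "(\<Sum>l\<in>UNIV. D_l (lam $ l) (g $ l) ((\<chi> l. m l) $ l)) \<le> D"
      using Ed sum_mono order_trans by (metis (no_types, lifting))
    \<comment> \<open>The choice \<open>s = m\<close> maximises the bound in \<open>KLb\<close> and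
      yields exactly the perception terms.\<close>
    have "(\<Sum>l\<in>UNIV. ((m l / lam $ l - 1 + ln (lam $ l / m l)) / 2)) \<le> P"
    proof -
      have *: "ln (lam $ l / m l) / 2 + m l / (2 * lam $ l) - m l / (2 * m l)
        = (m l / lam $ l - 1 + ln (lam $ l / m l)) / 2" for l
        using m_pos[of l] lam_pos[of l] by (simp add: field_simps)
      show ?thesis using KLb[of "\<chi> l. m l"] m_pos by (simp only: * vec_lambda_beta)
    qed
    moreover have "P_l (lam $ l) ((\<chi> l. m l) $ l) = ereal ((m l / lam $ l - 1 + ln (lam $ l / m l)) / 2)" for l
      using m_pos[of l] by (simp add: P_l_def)
    ultimately show "(\<Sum>l\<in>UNIV. P_l (lam $ l) ((\<chi> l. m l) $ l)) \<le> ereal P" by simp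
  qed
  moreover have "rdp_obj lam g \<le> R"
  proof -
    have "ln (lam $ l / g $ l) / 2 + lam $ l / (2 * lam $ l)
      - (lam $ l - 2 * (\<chi> l. c l / m l) $ l * c l + ((\<chi> l. c l / m l) $ l)\<^sup>2 * m l) / (2 * g $ l)
      = ln (lam $ l / g $ l) / 2" for l
      unfolding vec_lambda_beta g_eq using g_pos[of l] lam_pos[of l] by simp
    then show ?thesis
      using MIb[of g "\<chi> l. c l / m l"] g_pos by (simp only: rdp_obj_def) (simp add: sum_divide_distrib)
  qed
  ultimately show ?thesis using R by auto
qed

section \<open>The Gaussian coupling\<close>

text \<open>Here \<open>llr v 0 x 0\<close> is the exact log-density of \<open>G v\<close> against
  \<open>G lam\<close>, so \<open>KL_div_density_exp\<close> applies with second moments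
  \<open>v\<close>.\<close>

lemma KL_div_G_G:
  assumes v: "\<And>l. 0 < v $ l"
  shows "KL_div (G v) (G lam) = ereal (\<Sum>l\<in>UNIV. (v $ l / lam $ l - 1 + ln (lam $ l / v $ l)) / 2)"
proof -
  interpret L: prob_space "G lam" by (rule prob_space_G[OF lam_pos])
  interpret V: prob_space "G v" by (rule prob_space_G[OF v])
  have [measurable]: "(\<lambda>x. llr v 0 x 0) \<in> borel_measurable borel" using v by (rule llr_measurable)
  have "ennreal (gauss_dens lam (T x)) * ennreal (exp (llr v 0 x 0)) = ennreal (gauss_dens v (T x))" for x
  proof -
    have "scaled 0 0 = 0" by (simp add: vec_eq_iff)
    then show ?thesis
      unfolding exp_llr[OF v] using gauss_dens_pos[of lam "T x", OF lam_pos]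
      by (simp add: ennreal_mult''[symmetric])
  qed
  then have dens: "G v = density (G lam) (\<lambda>x. ennreal (exp (llr v 0 x 0)))"
    unfolding G_def by (subst density_density_eq) auto
  have i: "integrable (G v) (\<lambda>x. (T x $ l)\<^sup>2)" for l
    by (rule integrableI_nonneg) (auto simp: nn_integral_G_square[OF v])
  have I: "(\<integral>x. (T x $ l)\<^sup>2 \<partial>G v) = v $ l" for l
    using v[of l] by (subst integral_eq_nn_integral) (auto simp: nn_integral_G_square[OF v])
  have *: "ln (lam $ l / v $ l) / 2 + v $ l / (2 * lam $ l) - v $ l / (2 * v $ l)
      = (v $ l / lam $ l - 1 + ln (lam $ l / v $ l)) / 2" for l
    using v[of l] lam_pos[of l] by (simp add: field_simps)
  have "integrable (G v) (\<lambda>x. llr v 0 x 0)" unfolding llr_eq[OF v] using i by auto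
  then have "KL_div (G v) (G lam) = ereal (\<integral>x. llr v 0 x 0 \<partial>G v)"
    by (intro KL_div_density_exp[OF L.sigma_finite_measure_axioms _ dens]) auto
  also have "(\<integral>x. llr v 0 x 0 \<partial>G v)
      = (\<Sum>l\<in>UNIV. ln (lam $ l / v $ l) / 2 + v $ l / (2 * lam $ l) - v $ l / (2 * v $ l))"
    unfolding llr_eq[OF v] using i by (simp add: I V.prob_space[simplified])
  finally show ?thesis by (simp only: *)
qed

text \<open>The coupling is built backwards: the reconstruction has law \<open>G lh\<close> and the
  source given it is Gaussian with variances \<open>g\<close>. Normalisation of this channel gives
  the second marginal, \<open>normal_density_bayes\<close> the first.\<close>

lemma gaussian_coupling:
  assumes feas: "rdp_feasible lam D P lh g"
  obtains \<mu> where "\<mu> \<in> couplings (G lam)"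
    "(\<integral>\<^sup>+ z. ennreal ((norm (fst z - snd z))\<^sup>2) \<partial>\<mu>) \<le> ennreal D"
    "KL_div (distr \<mu> borel snd) (G lam) \<le> ereal P"
    "mutual_info \<mu> = ereal (rdp_obj lam g)"
proof -
  have g: "0 < g $ l" and g_le: "g $ l \<le> lam $ l" and lh: "0 < lh $ l" for l
    using feas by (auto simp: rdp_feasible_iff)
  \<comment> \<open>Chosen so that \<open>a w\<close> plus independent noise of variance
    \<open>g\<close> has the source variance.\<close>
  define a where "a = (\<chi> l. sqrt ((lam $ l - g $ l) / lh $ l))"
  have a: "(a $ l)\<^sup>2 * lh $ l + g $ l = lam $ l" for l
    using lh[of l] g_le[of l] by (simp add: a_def)
  \<comment> \<open>\<open>\<tau>\<close> and \<open>b\<close> are the variances and coefficients of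
    the forward channel, from source to reconstruction, in Bayes' rule.\<close>
  define \<tau> where "\<tau> = (\<chi> l. lh $ l * g $ l / lam $ l)"
  define b where "b = (\<chi> l. a $ l * lh $ l / lam $ l)"
  have \<tau>: "0 < \<tau> $ l" for l using lh[of l] g[of l] lam_pos[of l] by (simp add: \<tau>_def)
  have bayes: "gauss_dens g (T x - scaled a w) * gauss_dens lh (T w)
      = gauss_dens lam (T x) * gauss_dens \<tau> (T w - scaled b x)" for x w
    unfolding gauss_dens_def prod.distrib[symmetric]
  proof (rule prod.cong)
    fix l
    show "normal_density 0 (sqrt (g $ l)) ((T x - scaled a w) $ l) * normal_density 0 (sqrt (lh $ l)) (T w $ l)
       = normal_density 0 (sqrt (lam $ l)) (T x $ l) * normal_density 0 (sqrt (\<tau> $ l)) ((T w - scaled b x) $ l)"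
      using normal_density_bayes[OF g lh lam_pos a, of l "T x $ l" "T w $ l"] by (simp add: \<tau>_def b_def)
  qed simp
  interpret L: prob_space "G lam" by (rule prob_space_G[OF lam_pos])
  interpret N: prob_space "G lh" by (rule prob_space_G[OF lh])
  interpret LN: pair_prob_space "G lam" "G lh" ..
  let ?h = "\<lambda>z. llr g a (fst z) (snd z)"
  define \<mu> where "\<mu> = density (G lam \<Otimes>\<^sub>M G lh) (\<lambda>z. ennreal (exp (?h z)))"
  have [measurable]: "?h \<in> borel_measurable (borel \<Otimes>\<^sub>M borel)" using g by (rule llr_measurable)
  have [measurable]: "(\<lambda>w. llr g a x w) \<in> borel_measurable borel" for x using g by (rule llr_measurable)
  have [simp, measurable_cong]: "sets \<mu> = sets (borel \<Otimes>\<^sub>M borel)"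
    unfolding \<mu>_def by (simp cong: sets_pair_measure_cong)
  have nn_snd: "(\<integral>\<^sup>+z. F z \<partial>\<mu>) = (\<integral>\<^sup>+w. \<integral>\<^sup>+x. ennreal (gauss_dens g (T x - scaled a w)) * F (x, w) \<partial>lborel \<partial>G lh)"
    if [measurable]: "F \<in> borel_measurable (borel \<Otimes>\<^sub>M borel)" for F
  proof -
    have "(\<integral>\<^sup>+z. F z \<partial>\<mu>) = (\<integral>\<^sup>+z. ennreal (exp (?h z)) * F z \<partial>(G lam \<Otimes>\<^sub>M G lh))"
      unfolding \<mu>_def by (rule nn_integral_density) measurable
    also have "\<dots> = (\<integral>\<^sup>+w. \<integral>\<^sup>+x. ennreal (exp (?h (x, w))) * F (x, w) \<partial>G lam \<partial>G lh)"
      by (rule LN.nn_integral_snd[symmetric]) measurable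
    finally show ?thesis by (simp add: nn_integral_exp_llr[OF g])
  qed
  have snd: "distr \<mu> borel snd = G lh"
  proof (rule measure_eqI)
    fix A assume "A \<in> sets (distr \<mu> borel snd)"
    then have [measurable]: "A \<in> sets borel" by simp
    have "emeasure (distr \<mu> borel snd) A = (\<integral>\<^sup>+w. indicator A w \<partial>distr \<mu> borel snd)" by simp
    also have "\<dots> = (\<integral>\<^sup>+z. indicator A (snd z) \<partial>\<mu>)" by (rule nn_integral_distr) measurable
    also have "\<dots> = (\<integral>\<^sup>+w. \<integral>\<^sup>+x. ennreal (gauss_dens g (T x - scaled a w)) * indicator A (snd (x, w)) \<partial>lborel \<partial>G lh)"
      by (rule nn_snd) measurable
    also have "\<dots> = (\<integral>\<^sup>+w. indicator A w \<partial>G lh)"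
      by (simp add: nn_integral_multc nn_integral_gauss_dens_shift_1[OF g])
    finally show "emeasure (distr \<mu> borel snd) A = emeasure (G lh) A" by simp
  qed simp
  \<comment> \<open>By \<open>bayes\<close>, for fixed \<open>x\<close> the weight turns
    \<open>G lh\<close> into the forward channel law, which has mass \<open>1\<close>.\<close>
  have one: "(\<integral>\<^sup>+w. ennreal (exp (llr g a x w)) \<partial>G lh) = 1" for x
  proof -
    have "ennreal (gauss_dens lh (T w)) * ennreal (exp (llr g a x w))
        = ennreal (gauss_dens \<tau> (T w - scaled b x))" for w
    proof -
      have "gauss_dens lh (T w) * exp (llr g a x w) = gauss_dens \<tau> (T w - scaled b x)"
        using gauss_dens_pos[of lam "T x", OF lam_pos] bayes[of x w]
        by (simp add: exp_llr[OF g] nonzero_divide_eq_eq mult.commute)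
      then show ?thesis by (metis ennreal_mult exp_ge_zero gauss_dens_nonneg)
    qed
    then show ?thesis
      unfolding G_def by (subst nn_integral_density) (simp_all add: nn_integral_gauss_dens_shift_1[OF \<tau>])
  qed
  have fst: "distr \<mu> borel fst = G lam"
  proof (rule measure_eqI)
    fix A assume "A \<in> sets (distr \<mu> borel fst)"
    then have [measurable]: "A \<in> sets borel" by simp
    have "emeasure (distr \<mu> borel fst) A = (\<integral>\<^sup>+w. indicator A w \<partial>distr \<mu> borel fst)" by simp
    also have "\<dots> = (\<integral>\<^sup>+z. indicator A (fst z) \<partial>\<mu>)" by (rule nn_integral_distr) measurable
    also have "\<dots> = (\<integral>\<^sup>+z. ennreal (exp (?h z)) * indicator A (fst z) \<partial>(G lam \<Otimes>\<^sub>M G lh))"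
      unfolding \<mu>_def by (rule nn_integral_density) measurable
    also have "\<dots> = (\<integral>\<^sup>+x. \<integral>\<^sup>+w. ennreal (exp (?h (x, w))) * indicator A (fst (x, w)) \<partial>G lh \<partial>G lam)"
      by (rule N.nn_integral_fst[symmetric]) measurable
    also have "\<dots> = (\<integral>\<^sup>+x. indicator A x \<partial>G lam)"
      by (simp add: nn_integral_multc one)
    finally show "emeasure (distr \<mu> borel fst) A = emeasure (G lam) A" by simp
  qed simp
  have "prob_space (distr \<mu> borel fst)" using fst L.prob_space_axioms by simp
  then have "prob_space \<mu>" by (rule prob_space_distrD[rotated]) measurable
  interpret \<mu>: prob_space \<mu> by fact
  \<comment> \<open>The parameter \<open>s\<close> serves three purposes: \<open>s = 0\<close> gives
    the source moment, \<open>s = 1\<close> the distortion and \<open>s = a $ l\<close> the residual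
    in the log-likelihood ratio.\<close>
  have sq: "(\<integral>\<^sup>+z. ennreal ((T (fst z) $ l - s * T (snd z) $ l)\<^sup>2) \<partial>\<mu>)
      = ennreal (g $ l + (a $ l - s)\<^sup>2 * lh $ l)" for l s
  proof -
    have "(\<integral>\<^sup>+z. ennreal ((T (fst z) $ l - s * T (snd z) $ l)\<^sup>2) \<partial>\<mu>)
        = (\<integral>\<^sup>+w. ennreal (g $ l + (a $ l * T w $ l - s * T w $ l)\<^sup>2) \<partial>G lh)"
    proof (subst nn_snd)
      show "(\<lambda>z. ennreal ((T (fst z) $ l - s * T (snd z) $ l)\<^sup>2)) \<in> borel_measurable (borel \<Otimes>\<^sub>M borel)" by measurable
    qed (simp add: nn_integral_gauss_dens_shift_square[OF g])
    also have "\<dots> = (\<integral>\<^sup>+w. ennreal (g $ l) + ennreal ((a $ l - s)\<^sup>2) * ennreal ((T w $ l)\<^sup>2) \<partial>G lh)"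
    proof (rule nn_integral_cong)
      fix w
      have "(a $ l * T w $ l - s * T w $ l)\<^sup>2 = (a $ l - s)\<^sup>2 * (T w $ l)\<^sup>2"
        by (simp only: left_diff_distrib[symmetric] power_mult_distrib)
      then show "ennreal (g $ l + (a $ l * T w $ l - s * T w $ l)\<^sup>2)
          = ennreal (g $ l) + ennreal ((a $ l - s)\<^sup>2) * ennreal ((T w $ l)\<^sup>2)"
        using g[of l] by (simp add: ennreal_mult less_imp_le)
    qed
    also have "\<dots> = ennreal (g $ l) + ennreal ((a $ l - s)\<^sup>2) * ennreal (lh $ l)"
      by (simp add: nn_integral_add nn_integral_cmult nn_integral_G_square[OF lh] N.emeasure_space_1[simplified])
    also have "\<dots> = ennreal (g $ l + (a $ l - s)\<^sup>2 * lh $ l)"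
      using g[of l] lh[of l] by (simp add: ennreal_mult''[symmetric])
    finally show ?thesis .
  qed
  have i: "integrable \<mu> (\<lambda>z. (T (fst z) $ l - s * T (snd z) $ l)\<^sup>2)" for l s
    by (rule integrableI_nonneg) (auto simp: sq)
  have I: "(\<integral>z. (T (fst z) $ l - s * T (snd z) $ l)\<^sup>2 \<partial>\<mu>) = g $ l + (a $ l - s)\<^sup>2 * lh $ l" for l s
    using g[of l] lh[of l] by (subst integral_eq_nn_integral) (auto simp: sq simp del: ennreal_plus intro!: enn2real_ennreal add_nonneg_nonneg)
  have i0: "integrable \<mu> (\<lambda>z. (T (fst z) $ l)\<^sup>2)" for l
    using i[of l 0] unfolding mult_zero_left diff_zero .
  have I0: "(\<integral>z. (T (fst z) $ l)\<^sup>2 \<partial>\<mu>) = lam $ l" for l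
    using I[of l 0, unfolded mult_zero_left diff_zero] a[of l] by linarith
  have coup: "\<mu> \<in> couplings (G lam)"
    using \<open>prob_space \<mu>\<close> fst by (simp add: couplings_def)
  \<comment> \<open>The square is expanded by fact \<open>a\<close>; the root in \<open>D_l\<close>
    is \<open>a $ l * lh $ l\<close> because \<open>a $ l\<close> is nonnegative.\<close>
  have Dl: "g $ l + (a $ l - 1)\<^sup>2 * lh $ l = D_l (lam $ l) (g $ l) (lh $ l)" for l
  proof -
    have "lh $ l * (lam $ l - g $ l) = (a $ l * lh $ l)\<^sup>2"
      unfolding a[of l, symmetric] by (simp add: power2_eq_square)
    moreover have "0 \<le> a $ l * lh $ l" using lh[of l] g_le[of l] by (simp add: a_def)
    ultimately have sq: "sqrt (lh $ l * (lam $ l - g $ l)) = a $ l * lh $ l" by simp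
    have "g $ l + (a $ l - 1)\<^sup>2 * lh $ l = ((a $ l)\<^sup>2 * lh $ l + g $ l) - 2 * (a $ l * lh $ l) + lh $ l"
      by (simp add: power2_eq_square algebra_simps)
    then show ?thesis unfolding D_l_def sq a .
  qed
  have "(\<integral>\<^sup>+ z. ennreal ((norm (fst z - snd z))\<^sup>2) \<partial>\<mu>)
      = (\<integral>\<^sup>+z. (\<Sum>l\<in>UNIV. ennreal ((T (fst z) $ l - 1 * T (snd z) $ l)\<^sup>2)) \<partial>\<mu>)"
    by (rule nn_integral_cong) (simp add: norm_square_T)
  also have "\<dots> = (\<Sum>l\<in>UNIV. \<integral>\<^sup>+z. ennreal ((T (fst z) $ l - 1 * T (snd z) $ l)\<^sup>2) \<partial>\<mu>)"
    by (rule nn_integral_sum) measurable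
  also have "\<dots> = (\<Sum>l\<in>UNIV. ennreal (D_l (lam $ l) (g $ l) (lh $ l)))"
    unfolding sq Dl ..
  also have "\<dots> = ennreal (\<Sum>l\<in>UNIV. D_l (lam $ l) (g $ l) (lh $ l))"
    by (intro sum_ennreal, unfold Dl[symmetric])
       (intro add_nonneg_nonneg mult_nonneg_nonneg zero_le_power2 less_imp_le[OF g] less_imp_le[OF lh])
  also have "\<dots> \<le> ennreal D"
    using feas by (intro ennreal_leI) (simp add: rdp_feasible_iff)
  finally have dist: "(\<integral>\<^sup>+ z. ennreal ((norm (fst z - snd z))\<^sup>2) \<partial>\<mu>) \<le> ennreal D" .
  have KL: "KL_div (distr \<mu> borel snd) (G lam) \<le> ereal P"
    using feas by (simp add: snd KL_div_G_G[OF lh] rdp_feasible_iff)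
  have "integrable \<mu> ?h" unfolding llr_eq[OF g] using i i0 by auto
  then have "mutual_info \<mu> = ereal (\<integral>z. ?h z \<partial>\<mu>)"
    unfolding mutual_info_def fst snd
    by (intro KL_div_density_exp[OF LN.P.sigma_finite_measure_axioms _ \<mu>_def]) measurable
  \<comment> \<open>At \<open>s = a $ l\<close> the residual has second moment \<open>g $ l\<close>,
    so the two quadratic terms cancel below and only the logarithms remain.\<close>
  also have "(\<integral>z. ?h z \<partial>\<mu>) = (\<Sum>l\<in>UNIV. ln (lam $ l / g $ l) / 2 + lam $ l / (2 * lam $ l) - g $ l / (2 * g $ l))"
    unfolding llr_eq[OF g] using i i0 by (simp add: I I0 \<mu>.prob_space)
  also have "\<dots> = rdp_obj lam g"
    using g lam_pos by (simp add: rdp_obj_def sum_divide_distrib less_imp_neq[symmetric])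
  finally show thesis using that coup dist KL by blast
qed

end

section \<open>Identification of the rate-distortion-perception function\<close>

theorem theorem3:
  fixes \<Theta> :: "real^'n^'n" and lam :: "real^'n" and D P :: real
  assumes "orthogonal_matrix \<Theta>"
    and "\<forall>l. 0 < lam $ l"
    and "0 < D" and "0 \<le> P"
  shows "\<exists>lh g. rdp_feasible lam D P lh g
           \<and> (\<forall>lh' g'. rdp_feasible lam D P lh' g' \<longrightarrow> rdp_obj lam g \<le> rdp_obj lam g')
           \<and> RDP (gaussian_vec (transpose \<Theta> ** diag_mat lam ** \<Theta>)) D P = ereal (rdp_obj lam g)"
proof -
  interpret gaussian_source "(*v) \<Theta>" lam
    using assms by unfold_locales
      (simp_all add: orthogonal_transformation_matrix)
  have PX: "gaussian_vec (transpose \<Theta> ** diag_mat lam ** \<Theta>) = G lam"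
    unfolding G_def using assms by (intro gaussian_vec_eq) auto
  obtain lh g where feas: "rdp_feasible lam D P lh g"
    and min: "\<And>lh' g'. rdp_feasible lam D P lh' g' \<Longrightarrow> rdp_obj lam g \<le> rdp_obj lam g'"
    using rdp_minimizer_exists[OF lam_pos assms(3,4)] by blast
  have "RDP (G lam) D P = ereal (rdp_obj lam g)"
  proof (rule antisym)
    obtain \<mu> where \<mu>: "\<mu> \<in> couplings (G lam)"
      "(\<integral>\<^sup>+ z. ennreal ((norm (fst z - snd z))\<^sup>2) \<partial>\<mu>) \<le> ennreal D"
      "KL_div (distr \<mu> borel snd) (G lam) \<le> ereal P" "mutual_info \<mu> = ereal (rdp_obj lam g)"
      using gaussian_coupling[OF feas] .
    show "RDP (G lam) D P \<le> ereal (rdp_obj lam g)"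
      unfolding RDP_def \<mu>(4)[symmetric] by (rule INF_lower) (use \<mu> in simp)
    show "ereal (rdp_obj lam g) \<le> RDP (G lam) D P"
      unfolding RDP_def
    proof (rule INF_greatest)
      fix \<nu> assume "\<nu> \<in> {\<mu> \<in> couplings (G lam).
        (\<integral>\<^sup>+ z. ennreal ((norm (fst z - snd z))\<^sup>2) \<partial>\<mu>) \<le> ennreal D
        \<and> KL_div (distr \<mu> borel snd) (G lam) \<le> ereal P}"
      then have \<nu>: "\<nu> \<in> couplings (G lam)" "(\<integral>\<^sup>+ z. ennreal ((norm (fst z - snd z))\<^sup>2) \<partial>\<nu>) \<le> ennreal D"
        "KL_div (distr \<nu> borel snd) (G lam) \<le> ereal P" by auto
      show "ereal (rdp_obj lam g) \<le> mutual_info \<nu>"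
      proof (cases "mutual_info \<nu> = \<infinity>")
        case False
        then obtain lh' g' where "rdp_feasible lam D P lh' g'" "ereal (rdp_obj lam g') \<le> mutual_info \<nu>"
          using coupling_feasible_point[OF \<nu>(1) assms(3) \<nu>(2,3)] by blast
        then show ?thesis using min by (meson ereal_less_eq(3) order_trans)
      qed simp
    qed
  qed
  then show ?thesis unfolding PX using feas min by blast
qed

end
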